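(* If $T$ is a tree having at least one non-leaf vertex and $\delta'(T)\geq 4$, then $L_2(T)\leq\frac{2}{3}|V(T)|$.
   Context: All graphs are finite, undirected, simple and nontrivial (at least two vertices). A leaf is a vertex of degree $1$; $\delta'(G)$ denotes the minimum degree of $G$ taken over all non-leaf vertices. $N[v]=\{v\}\cup N(v)$ is the closed neighbourhood of $v$. A set $B\subseteq V(G)$ is a $2$-limited packing if $|N[v]\cap B|\le 2$ for every vertex $v$ of $G$; $L_2(G)$ is the maximum cardinality of a $2$-limited packing in $G$. *)

theory Defs
  imports Complex_Main "Graph_Theory.Digraph_Component"
begin

text \<open>
  A finite simple graph is a structure satisfying the locale \<^locale>\<open>graph\<close>: a finite symmetric
  loopfree digraph without parallel arcs, in which an undirected edge \<open>uv\<close> is the pair of arcs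
  \<open>u \<rightarrow> v\<close> and \<open>v \<rightarrow> u\<close>. The degree of a vertex is therefore its \<^const>\<open>out_degree\<close>.
\<close>

definition neighbourhood :: "('a, 'b) pre_digraph \<Rightarrow> 'a \<Rightarrow> 'a set" where
  "neighbourhood G v = {w. v \<rightarrow>\<^bsub>G\<^esub> w}"

definition closed_neighbourhood :: "('a, 'b) pre_digraph \<Rightarrow> 'a \<Rightarrow> 'a set" where
  "closed_neighbourhood G v = insert v (neighbourhood G v)"

text \<open>
  The library's \<^const>\<open>pre_digraph.cycle\<close> counts \<open>a, b, a\<close> as a cycle, so that no symmetric digraph
  with an edge satisfies the library's \<open>forest\<close> or \<open>tree\<close>. In a simple graph the cycles are those
  of length at least 3.
\<close>

definition undirected_cycle :: "('a, 'b) pre_digraph \<Rightarrow> 'b list \<Rightarrow> bool" where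
  "undirected_cycle G p \<longleftrightarrow> pre_digraph.cycle G p \<and> 3 \<le> length p"

definition undirected_tree :: "('a, 'b) pre_digraph \<Rightarrow> bool" where
  "undirected_tree G \<longleftrightarrow>
     graph G \<and> Digraph_Component.connected G \<and> (\<nexists>p. undirected_cycle G p)"

definition leaf :: "('a, 'b) pre_digraph \<Rightarrow> 'a \<Rightarrow> bool" where
  "leaf G v \<longleftrightarrow> v \<in> verts G \<and> out_degree G v = 1"

definition non_leaves :: "('a, 'b) pre_digraph \<Rightarrow> 'a set" where
  "non_leaves G = {v \<in> verts G. \<not> leaf G v}"

text \<open>The parameter \<open>\<delta>'\<close>; meaningful only if \<open>G\<close> is finite and has a non-leaf vertex.\<close>

definition min_nonleaf_degree :: "('a, 'b) pre_digraph \<Rightarrow> nat" where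
  "min_nonleaf_degree G = Min (out_degree G ` non_leaves G)"

definition limited_packing :: "nat \<Rightarrow> ('a, 'b) pre_digraph \<Rightarrow> 'a set \<Rightarrow> bool" where
  "limited_packing k G B \<longleftrightarrow>
     B \<subseteq> verts G \<and> (\<forall>v \<in> verts G. card (closed_neighbourhood G v \<inter> B) \<le> k)"

definition limited_packing_number :: "nat \<Rightarrow> ('a, 'b) pre_digraph \<Rightarrow> nat" where
  "limited_packing_number k G = Max (card ` {B. limited_packing k G B})"

text \<open>The \<^const>\<open>Max\<close> above is taken over a finite nonempty set when \<open>G\<close> is finite.\<close>

lemma finite_limited_packings:
  assumes "finite (verts G)"
  shows "finite {B. limited_packing k G B}"
  by (rule finite_subset[of _ "Pow (verts G)"]) (auto simp: limited_packing_def assms)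

lemma limited_packing_empty: "limited_packing k G {}"
  by (simp add: limited_packing_def)

lemma (in graph) out_degree_eq_card_neighbourhood:
  "out_degree G v = card (neighbourhood G v)"
proof -
  have "neighbourhood G v = head G ` out_arcs G v"
    by (auto simp: neighbourhood_def arcs_ends_conv)
  moreover have "inj_on (head G) (out_arcs G v)"
    by (rule inj_onI) (auto intro: no_multi_arcs simp: arc_to_ends_def)
  ultimately show ?thesis
    by (simp add: out_degree_def card_image)
qed

end

theory Submission
  imports Defs
begin

text \<open>
  Every vertex of \<open>T\<close> lies in the closed neighbourhood of some non-leaf, so a 2-limited packing has
  at most \<open>2 |N|\<close> elements, where \<open>N\<close> is the set of non-leaves. On the other hand a forest has
  degree sum at most \<open>2 |V|\<close>, while here it is at least \<open>4 |N| + (|V| - |N|)\<close>; hence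
  \<open>3 |N| \<le> |V|\<close>.
\<close>

lemma (in graph) neighbourhood_subset_verts: "neighbourhood G v \<subseteq> verts G"
  by (auto simp: neighbourhood_def)

lemma (in graph) finite_neighbourhood [simp]: "finite (neighbourhood G v)"
  by (rule finite_subset[OF neighbourhood_subset_verts]) simp

lemma (in graph) neighbourhood_commute:
  "w \<in> neighbourhood G v \<longleftrightarrow> v \<in> neighbourhood G w"
  using symmetric_conv sym_arcs by (auto simp: neighbourhood_def arcs_ends_conv symmetric_conv)

lemma (in graph) not_in_neighbourhood_self [simp]: "v \<notin> neighbourhood G v"
  using adj_not_same by (auto simp: neighbourhood_def)

text \<open>By symmetry the arc can be chosen to point into \<open>v\<close>, the direction needed
  to prepend it to a walk starting at \<open>v\<close>.\<close>

lemma (in graph) neighbourhood_arcE: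
  assumes "w \<in> neighbourhood G v"
  obtains e where "e \<in> arcs G" "tail G e = w" "head G e = v"
  using assms neighbourhood_commute[of w v] by (auto simp: neighbourhood_def arcs_ends_conv)

text \<open>Take a longest path inside \<open>S\<close>. If its first vertex had two neighbours in
  \<open>S\<close>, both would lie on the path, and one that is not the second vertex would close a
  cycle of length at least 3.\<close>

lemma (in graph) ex_degree_le_one_if_acyclic:
  assumes acyclic: "\<nexists>p. undirected_cycle G p" and "S \<subseteq> verts G" "S \<noteq> {}"
  shows "\<exists>v\<in>S. card (neighbourhood G v \<inter> S) \<le> 1"
proof (rule ccontr)
  assume contra: "\<not> ?thesis"
  define P where "P p \<longleftrightarrow> (\<exists>u v. apath u p v \<and> set (awalk_verts u p) \<subseteq> S)" for p
  obtain s where "s \<in> S" "s \<in> verts G" using assms by auto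
  then have "P []" by (auto simp: P_def apath_Nil_iff)
  moreover have "\<forall>q. P q \<longrightarrow> length q < card (verts G)"
    using length_apath_less by (auto simp: P_def)
  ultimately obtain p where "P p" and longest: "\<And>q. P q \<Longrightarrow> length q \<le> length p"
    using ex_has_greatest_nat[of P "[]" length] by blast
  then obtain u v where p: "apath u p v" "set (awalk_verts u p) \<subseteq> S" by (auto simp: P_def)
  then have "u \<in> S" using hd_in_awalk_verts(2) by blast
  \<comment> \<open>Otherwise prepending the arc from \<open>w\<close> to \<open>u\<close> would
    give a longer path inside \<open>S\<close>.\<close>
  have nbrs_on_path: "w \<in> set (awalk_verts u p)" if w: "w \<in> neighbourhood G u" "w \<in> S" for w
  proof (rule ccontr)
    assume off: "w \<notin> set (awalk_verts u p)"
    from w(1) obtain e where "e \<in> arcs G" "tail G e = w" "head G e = u"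
      by (rule neighbourhood_arcE)
    with p off w have "P (e # p)" by (auto simp: P_def apath_Cons_iff)
    with longest[of "e # p"] show False by simp
  qed
  \<comment> \<open>The second vertex of the path. If \<open>p\<close> is empty, \<open>x\<close> is
    unspecified, which is harmless: \<open>w\<close> then lies on the path \<open>[u]\<close>, so
    \<open>w = u\<close>, which is excluded below.\<close>
  define x where "x = head G (hd p)"
  obtain w where w: "w \<in> neighbourhood G u" "w \<in> S" "w \<noteq> x"
  proof (rule ccontr)
    assume "\<not> thesis"
    with that have "neighbourhood G u \<inter> S \<subseteq> {x}" by auto
    then have "card (neighbourhood G u \<inter> S) \<le> 1"
      using card_mono[of "{x}"] by simp
    with contra \<open>u \<in> S\<close> show False by blast
  qed
  from p(1) have "cas u p v" by (auto simp: apath_def)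
  obtain xs ys where xs: "awalk_verts u p = xs @ w # ys"
    using nbrs_on_path[OF w(1,2)] by (meson split_list)
  obtain q r where q: "cas u q w" "p = q @ r" "awalk_verts u q = xs @ [w]"
    using awalk_decomp_verts[OF \<open>cas u p v\<close> xs] by metis
  then have dist: "distinct (awalk_verts u q)"
    using p(1) xs by (auto simp: apath_def)
  have "awalk u q w"
    using q p(1) by (auto simp: apath_def awalk_def)
  obtain f where f: "f \<in> arcs G" "tail G f = w" "head G f = u"
    using w(1) by (rule neighbourhood_arcE)
  have "w \<noteq> u" using w(1) by auto
  then have "q \<noteq> []" using q by auto
  \<comment> \<open>A one-arc prefix would end at the second vertex \<open>x\<close>, but
    \<open>w\<close> was chosen different from \<open>x\<close>. This rules out the degenerate
    closed walk \<open>u\<close>, \<open>w\<close>, \<open>u\<close>.\<close>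
  moreover have "q \<noteq> [e]" for e
    using q w(3) by (auto simp: x_def)
  ultimately have "2 \<le> length q"
    by (cases q rule: remdups_adj.cases) auto
  \<comment> \<open>The arc \<open>f\<close> leads from \<open>w\<close> to \<open>u\<close>, and
    \<open>q\<close> leads back to \<open>w\<close> along the path.\<close>
  moreover have "cycle (f # q)"
    using f \<open>awalk u q w\<close> dist by (auto simp: cycle_def awalk_Cons_iff)
  ultimately have "undirected_cycle G (f # q)"
    by (simp add: undirected_cycle_def)
  with acyclic show False by blast
qed

text \<open>Delete a vertex with at most one neighbour in \<open>S\<close> and use induction: the
  degree sum drops by at most 2, once for the vertex itself and once for its neighbour.\<close>

lemma (in graph) sum_degree_le_if_acyclic:
  assumes acyclic: "\<nexists>p. undirected_cycle G p" and "S \<subseteq> verts G"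
  shows "(\<Sum>v\<in>S. card (neighbourhood G v \<inter> S)) \<le> 2 * card S"
proof -
  have "finite S" using finite_subset[OF assms(2)] by simp
  then show ?thesis using assms(2)
  proof (induction S rule: finite_remove_induct)
    case (remove S)
    let ?d = "\<lambda>S v. card (neighbourhood G v \<inter> S)"
    obtain v where v: "v \<in> S" "?d S v \<le> 1"
      using ex_degree_le_one_if_acyclic[OF acyclic] remove by blast
    have "?d S w = ?d (S - {v}) w + of_bool (w \<in> neighbourhood G v)" for w
    proof (cases "w \<in> neighbourhood G v")
      case True
      then have "v \<in> neighbourhood G w" using neighbourhood_commute by blast
      with v have "neighbourhood G w \<inter> S = insert v (neighbourhood G w \<inter> (S - {v}))" by auto
      with True show ?thesis by simp
    next
      case False
      then have "v \<notin> neighbourhood G w" using neighbourhood_commute by blast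
      then have "neighbourhood G w \<inter> S = neighbourhood G w \<inter> (S - {v})" by auto
      with False show ?thesis by simp
    qed
    \<comment> \<open>Summing the indicator of adjacency to \<open>v\<close> counts the neighbours
      of \<open>v\<close> in \<open>S\<close>, so the degree of \<open>v\<close> appears a second
      time next to its own summand.\<close>
    then have "(\<Sum>w\<in>S - {v}. ?d S w)
        = (\<Sum>w\<in>S - {v}. ?d (S - {v}) w) + card ((S - {v}) \<inter> neighbourhood G v)"
      using remove by (simp add: sum.distrib of_bool_def sum.If_cases)
    also have "(S - {v}) \<inter> neighbourhood G v = neighbourhood G v \<inter> S" by auto
    also have "(\<Sum>w\<in>S - {v}. ?d (S - {v}) w) \<le> 2 * card (S - {v})"
      using remove v by blast
    finally have "(\<Sum>w\<in>S. ?d S w) \<le> 2 * card (S - {v}) + 2 * ?d S v"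
      using remove v by (simp add: sum.remove[of S v])
    also have "\<dots> \<le> 2 * card (S - {v}) + 2" using v by simp
    also have "\<dots> = 2 * card S"
      using remove v by (simp add: card_Suc_Diff1[symmetric, of S v] del: card_Diff_insert)
    finally show ?case .
  qed simp
qed

text \<open>If the only neighbour \<open>w\<close> of \<open>u\<close> were a leaf too, then
  \<open>{u, w}\<close> would be a whole component, and connectedness would leave no room for a
  non-leaf.\<close>

lemma (in graph) leaf_adjacent_non_leaf:
  assumes "Digraph_Component.connected G" "non_leaves G \<noteq> {}" "leaf G u"
  shows "\<exists>w\<in>non_leaves G. u \<in> neighbourhood G w"
proof -
  have nbr_leaf: "\<exists>y. neighbourhood G x = {y}" if "leaf G x" for x
    using that by (simp add: leaf_def out_degree_eq_card_neighbourhood card_1_singleton_iff)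
  then obtain w where w: "neighbourhood G u = {w}" using assms(3) by blast
  then have uw: "u \<in> neighbourhood G w" using neighbourhood_commute by blast
  have "w \<in> verts G" using w neighbourhood_subset_verts by blast
  have "\<not> leaf G w"
  proof
    assume "leaf G w"
    then have w': "neighbourhood G w = {u}" using nbr_leaf uw by force
    obtain r where r: "r \<in> verts G" "\<not> leaf G r" using assms(2) by (auto simp: non_leaves_def)
    have "u \<rightarrow>\<^sup>*\<^bsub>G\<^esub> r"
      using symmetric_connected_imp_strongly_connected[OF sym_arcs assms(1)] r assms(3)
      by (auto simp: leaf_def)
    \<comment> \<open>The set \<open>{u, w}\<close> is closed under adjacency, so reachability from
      \<open>u\<close> never leaves it.\<close>
    then have "r \<in> {u, w}"
    proof (induction rule: reachable_induct)
      case (step x y)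
      then show ?case using w w' by (auto simp: neighbourhood_def)
    qed simp
    with r \<open>leaf G w\<close> assms(3) show False by auto
  qed
  with uw \<open>w \<in> verts G\<close> show ?thesis by (auto simp: non_leaves_def)
qed

text \<open>The closed neighbourhoods of the non-leaves cover all vertices: a non-leaf lies in its
  own, a leaf in that of its neighbour. Each of them meets \<open>B\<close> in at most
  \<open>k\<close> vertices.\<close>

lemma (in graph) card_limited_packing_le:
  assumes "Digraph_Component.connected G" "non_leaves G \<noteq> {}" "limited_packing k G B"
  shows "card B \<le> k * card (non_leaves G)"
proof -
  have fin: "finite (non_leaves G)" by (simp add: non_leaves_def)
  have "B \<subseteq> (\<Union>v\<in>non_leaves G. closed_neighbourhood G v \<inter> B)"
  proof
    fix b assume "b \<in> B"
    then have "b \<in> verts G" using assms(3) by (auto simp: limited_packing_def)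
    then have "\<exists>v\<in>non_leaves G. b \<in> closed_neighbourhood G v"
      using leaf_adjacent_non_leaf[OF assms(1,2)]
      by (cases "leaf G b") (auto simp: closed_neighbourhood_def non_leaves_def)
    with \<open>b \<in> B\<close> show "b \<in> (\<Union>v\<in>non_leaves G. closed_neighbourhood G v \<inter> B)" by blast
  qed
  then have "card B \<le> card (\<Union>v\<in>non_leaves G. closed_neighbourhood G v \<inter> B)"
    using fin by (intro card_mono) (auto simp: closed_neighbourhood_def)
  also have "\<dots> \<le> (\<Sum>v\<in>non_leaves G. card (closed_neighbourhood G v \<inter> B))"
    using fin by (rule card_UN_le)
  also have "\<dots> \<le> (\<Sum>v\<in>non_leaves G. k)"
    using assms(3) by (intro sum_mono) (auto simp: limited_packing_def non_leaves_def)
  finally show ?thesis by (simp add: mult.commute)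
qed

lemma (in graph) three_card_non_leaves_le:
  assumes "\<nexists>p. undirected_cycle G p" "non_leaves G \<noteq> {}" "4 \<le> min_nonleaf_degree G"
  shows "3 * card (non_leaves G) \<le> card (verts G)"
proof -
  let ?N = "non_leaves G" and ?L = "verts G - non_leaves G"
  have N: "?N \<subseteq> verts G" "finite ?N" by (auto simp: non_leaves_def)
  have "4 * card ?N + card ?L = (\<Sum>v\<in>?N. 4) + (\<Sum>v\<in>?L. 1)" by simp
  also have "\<dots> \<le> (\<Sum>v\<in>?N. out_degree G v) + (\<Sum>v\<in>?L. out_degree G v)"
  proof (intro add_mono sum_mono)
    fix v assume "v \<in> ?N"
    then have "min_nonleaf_degree G \<le> out_degree G v"
      using N by (simp add: min_nonleaf_degree_def)
    with assms(3) show "4 \<le> out_degree G v" by simp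
  qed (auto simp: non_leaves_def leaf_def)
  also have "\<dots> = (\<Sum>v\<in>verts G. out_degree G v)"
    using N by (simp add: sum.subset_diff[OF N(1)])
  also have "\<dots> = (\<Sum>v\<in>verts G. card (neighbourhood G v \<inter> verts G))"
    using neighbourhood_subset_verts
    by (simp add: out_degree_eq_card_neighbourhood Int_absorb2)
  also have "\<dots> \<le> 2 * card (verts G)"
    using sum_degree_le_if_acyclic[OF assms(1)] by blast
  \<comment> \<open>Replace \<open>card ?L\<close> by \<open>card (verts G) - card ?N\<close>;
    \<open>card_mono\<close> ensures that this subtraction of naturals does not truncate.\<close>
  finally show ?thesis
    using N card_mono[of "verts G" ?N] by (simp add: card_Diff_subset)
qed

theorem theorem4p3:
  fixes T :: "('a, 'b) pre_digraph"
  assumes "undirected_tree T"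
    and "2 \<le> card (verts T)"
    and "non_leaves T \<noteq> {}"
    and "4 \<le> min_nonleaf_degree T"
  shows "real (limited_packing_number 2 T) \<le> 2 / 3 * real (card (verts T))"
proof -
  interpret graph T using assms(1) by (simp add: undirected_tree_def)
  \<comment> \<open>The maximum is attained, since there are finitely many packings and the empty
    set is one; hence it suffices to bound a single packing \<open>B\<close>.\<close>
  have "limited_packing_number 2 T \<in> card ` {B. limited_packing 2 T B}"
    unfolding limited_packing_number_def
    using finite_limited_packings[of T 2] limited_packing_empty[of 2 T] by (intro Max_in) auto
  then obtain B where "limited_packing 2 T B" "limited_packing_number 2 T = card B" by auto
  then have "limited_packing_number 2 T \<le> 2 * card (non_leaves T)"
    using card_limited_packing_le assms by (auto simp: undirected_tree_def)
  moreover have "3 * card (non_leaves T) \<le> card (verts T)"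
    using three_card_non_leaves_le assms by (auto simp: undirected_tree_def)
  ultimately show ?thesis by linarith
qed

end
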